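(* Let $G=(V,E)$ be a complete undirected graph with $|V|\ge3$, let $w:2^E\to\mathbb{R}_{\ge0}$ be a monotone submodular function, let $c:E\to\mathbb{R}_{\ge0}$ be edge costs with $c(S)=\sum_{e\in S}c(e)$, let $M=\max_{e\in E}c(e)$, let $\beta\in[0,1]$, and let $$f(S)=(1-\beta)w(S)-\beta c(S),\qquad S\subseteq E.$$ Let $\mathcal{H}$ be the set of (edge sets of) all tours of $G$ and $\mathrm{OPT}=\max_{S\in\mathcal{H}}f(S)$. Then the 2-matching tour algorithm, applied to this objective via the modified function $f'(S)=f(S)+\beta|S|M$ (see context), outputs a tour $T$ with $$f(T)\ \ge\ \frac29\,\mathrm{OPT}-\frac79\,\beta M|V|.$$
   Context: A tour is (the edge set of) a Hamiltonian cycle of $G$. A (simple) 2-matching is a set of edges in which every vertex has degree at most $2$. A function $w$ is submodular if $w(S)+w(T)\ge w(S\cup T)+w(S\cap T)$ for all $S,T\subseteq E$, and monotone if $A\subseteq B$ implies $w(A)\le w(B)$. The modified objective is $$f'(S)=(1-\beta)w(S)+\beta\,(|S|M-c(S))=f(S)+\beta|S|M,$$ a monotone non-negative submodular function. The 2-matching tour algorithm, run with $f'$: (1) Compute a 2-matching $M_1$ greedily: start with $M_1=\emptyset$, repeatedly take the not-yet-considered edge $e$ with largest $f'(M_1\cup\{e\})-f'(M_1)$, add it if both endpoints have degree less than $2$ in $M_1$, otherwise discard it. Also compute an inclusion-maximal maximum-weight 2-matching $M_2$ for the edge weights $e\mapsto f'(\{e\})$. Let $N$ be whichever of $M_1,M_2$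 has the larger value of $f'$. As a maximal 2-matching of a complete graph, $N$ is a vertex-disjoint union of simple cycles together with at most one extra edge or one isolated vertex. (2) Let $A^1,\dots,A^m$ be the edge sets of the cycles of $N$, $k=\min_j|A^j|$, and enumerate $A^j=\{a^j_1,\dots,a^j_{n_j}\}$. For $i=1,2,\dots$ set $U=\{a^1_i,\dots,a^m_i\}$, stopping at the first $i$ with $f'(N\setminus U)\ge\frac{k-1}{k}f'(N)$. (3) Connect the vertex-disjoint simple paths of $N\setminus U$ (including isolated vertices) arbitrarily into a tour by adding edges between vertices of degree $0$ or $1$. *)

theory Defs
  imports Complex_Main
begin

text \<open>Undirected edges are two-element vertex sets; a set of edges has type \<open>'v set set\<close>.\<close>

definition complete_edges :: "'v set \<Rightarrow> 'v set set" where
  "complete_edges V = {{u, v} | u v. u \<in> V \<and> v \<in> V \<and> u \<noteq> v}"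

definition degree :: "'v set set \<Rightarrow> 'v \<Rightarrow> nat" where
  "degree S v = card {e \<in> S. v \<in> e}"

definition closed_walk_edges :: "'v list \<Rightarrow> 'v set set" where
  "closed_walk_edges vs = {{vs ! i, vs ! (Suc i mod length vs)} | i. i < length vs}"

definition is_cycle :: "'v set set \<Rightarrow> bool" where
  "is_cycle A \<longleftrightarrow> (\<exists>vs. distinct vs \<and> 3 \<le> length vs \<and> A = closed_walk_edges vs)"

definition tours :: "'v set \<Rightarrow> 'v set set set" where
  "tours V = {closed_walk_edges vs | vs. distinct vs \<and> 3 \<le> length vs \<and> set vs = V}"

definition two_matching :: "'v set \<Rightarrow> 'v set set \<Rightarrow> bool" where
  "two_matching V S \<longleftrightarrow> S \<subseteq> complete_edges V \<and> (\<forall>v\<in>V. degree S v \<le> 2)"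

definition submodular_on :: "'a set \<Rightarrow> ('a set \<Rightarrow> real) \<Rightarrow> bool" where
  "submodular_on E w \<longleftrightarrow>
     (\<forall>S T. S \<subseteq> E \<longrightarrow> T \<subseteq> E \<longrightarrow> w S + w T \<ge> w (S \<union> T) + w (S \<inter> T))"

definition objective :: "real \<Rightarrow> ('e set \<Rightarrow> real) \<Rightarrow> ('e \<Rightarrow> real) \<Rightarrow> 'e set \<Rightarrow> real" where
  "objective \<beta> w c S = (1 - \<beta>) * w S - \<beta> * (\<Sum>e\<in>S. c e)"

definition modified_objective ::
    "real \<Rightarrow> ('e set \<Rightarrow> real) \<Rightarrow> ('e \<Rightarrow> real) \<Rightarrow> real \<Rightarrow> 'e set \<Rightarrow> real" where
  "modified_objective \<beta> w c M S = objective \<beta> w c S + \<beta> * real (card S) * M"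

text \<open>The algorithm leaves several choices open (ties, enumerations of the cycles, the
  connecting edges). It is therefore modelled by relations that admit every legal choice.
  The parameter \<open>g\<close> is the set function the algorithm is run with.\<close>

text \<open>\<open>greedy_run V g C S\<close>: the greedy procedure can reach the current 2-matching \<open>S\<close>
  having considered exactly the edges in \<open>C\<close>.\<close>

inductive greedy_run ::
    "'v set \<Rightarrow> ('v set set \<Rightarrow> real) \<Rightarrow> 'v set set \<Rightarrow> 'v set set \<Rightarrow> bool"
  for V g where
  start: "greedy_run V g {} {}"
| step: "greedy_run V g C S \<Longrightarrow> e \<in> complete_edges V - C \<Longrightarrow>
    (\<forall>e' \<in> complete_edges V - C. g (S \<union> {e'}) - g S \<le> g (S \<union> {e}) - g S) \<Longrightarrow>
    greedy_run V g (insert e C) (if \<forall>v\<in>e. degree S v < 2 then insert e S else S)"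

definition greedy_two_matching ::
    "'v set \<Rightarrow> ('v set set \<Rightarrow> real) \<Rightarrow> 'v set set \<Rightarrow> bool" where
  "greedy_two_matching V g S \<longleftrightarrow> greedy_run V g (complete_edges V) S"

definition max_weight_two_matching ::
    "'v set \<Rightarrow> ('v set \<Rightarrow> real) \<Rightarrow> 'v set set \<Rightarrow> bool" where
  "max_weight_two_matching V wt S \<longleftrightarrow>
     two_matching V S \<and>
     (\<forall>S'. two_matching V S' \<longrightarrow> (\<Sum>e\<in>S'. wt e) \<le> (\<Sum>e\<in>S. wt e)) \<and>
     (\<forall>S'. two_matching V S' \<and> S \<subseteq> S' \<longrightarrow> S' = S)"

definition initial_two_matching ::
    "'v set \<Rightarrow> ('v set set \<Rightarrow> real) \<Rightarrow> 'v set set \<Rightarrow> bool" where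
  "initial_two_matching V g N \<longleftrightarrow>
     (\<exists>M1 M2. greedy_two_matching V g M1 \<and>
        max_weight_two_matching V (\<lambda>e. g {e}) M2 \<and>
        N \<in> {M1, M2} \<and> g N = max (g M1) (g M2))"

definition cycles_of :: "'v set set \<Rightarrow> 'v set set set" where
  "cycles_of N = {A. A \<subseteq> N \<and> is_cycle A}"

definition min_cycle_length :: "'v set set \<Rightarrow> nat" where
  "min_cycle_length N = Min (card ` cycles_of N)"

text \<open>\<open>a A i\<close> is the \<open>i\<close>-th edge of the cycle \<open>A\<close>, counting from 1.\<close>

definition cycle_enumeration :: "'v set set \<Rightarrow> ('v set set \<Rightarrow> nat \<Rightarrow> 'v set) \<Rightarrow> bool" where
  "cycle_enumeration N a \<longleftrightarrow> (\<forall>A \<in> cycles_of N. bij_betw (a A) {1..card A} A)"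

definition removed_edges ::
    "'v set set \<Rightarrow> ('v set set \<Rightarrow> nat \<Rightarrow> 'v set) \<Rightarrow> nat \<Rightarrow> 'v set set" where
  "removed_edges N a i = {a A i | A. A \<in> cycles_of N}"

definition good_index ::
    "('v set set \<Rightarrow> real) \<Rightarrow> 'v set set \<Rightarrow> ('v set set \<Rightarrow> nat \<Rightarrow> 'v set) \<Rightarrow> nat \<Rightarrow> bool" where
  "good_index g N a i \<longleftrightarrow>
     g (N - removed_edges N a i)
       \<ge> (real (min_cycle_length N) - 1) / real (min_cycle_length N) * g N"

text \<open>Only indices up to the minimal cycle length are meaningful: beyond it some \<open>a A i\<close>
  is not an edge of \<open>A\<close>.\<close>

definition stopping_index ::
    "('v set set \<Rightarrow> real) \<Rightarrow> 'v set set \<Rightarrow> ('v set set \<Rightarrow> nat \<Rightarrow> 'v set) \<Rightarrow> nat \<Rightarrow> bool" where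
  "stopping_index g N a i \<longleftrightarrow>
     i \<in> {1..min_cycle_length N} \<and> good_index g N a i \<and> (\<forall>j \<in> {1..<i}. \<not> good_index g N a j)"

definition connects_to_tour :: "'v set \<Rightarrow> 'v set set \<Rightarrow> 'v set set \<Rightarrow> bool" where
  "connects_to_tour V P T \<longleftrightarrow>
     T \<in> tours V \<and> P \<subseteq> T \<and> (\<forall>e \<in> T - P. \<forall>v\<in>e. degree P v \<le> 1)"

text \<open>A run of the algorithm first fixes \<open>N\<close> and the enumeration \<open>a\<close> of its cycles, and
  then computes an output from them.\<close>

definition tour_alg_choices ::
    "'v set \<Rightarrow> ('v set set \<Rightarrow> real) \<Rightarrow> 'v set set \<Rightarrow> ('v set set \<Rightarrow> nat \<Rightarrow> 'v set) \<Rightarrow> bool" where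
  "tour_alg_choices V g N a \<longleftrightarrow> initial_two_matching V g N \<and> cycle_enumeration N a"

definition tour_alg_output ::
    "'v set \<Rightarrow> ('v set set \<Rightarrow> real) \<Rightarrow> 'v set set \<Rightarrow> ('v set set \<Rightarrow> nat \<Rightarrow> 'v set)
      \<Rightarrow> 'v set set \<Rightarrow> bool" where
  "tour_alg_output V g N a T \<longleftrightarrow>
     (\<exists>i. stopping_index g N a i \<and> connects_to_tour V (N - removed_edges N a i) T)"

end

theory Submission
  imports Defs
begin

text \<open>
  The modified objective adds \<open>\<beta> M\<close> for every edge. This makes it a nonnegative monotone
  submodular function, and since every tour has exactly \<open>|V|\<close> edges it shifts the value of
  tours by the constant \<open>\<beta> M |V|\<close>. A guarantee with factor \<open>2 / 9\<close> for the modified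
  objective therefore turns into the stated one, the constant being \<open>1 - 2 / 9 = 7 / 9\<close>.

  The factor \<open>2 / 9\<close> is a product. A greedy 2-matching has at least a third of the value of any
  2-matching, in particular of an optimal tour: accepting an edge makes at most two edges of a
  2-matching infeasible, one at each end, and each of them would have gained no more than the
  accepted edge (\<open>greedy_run_invariant\<close>). The cycles of \<open>N\<close> have at least three edges
  and are disjoint (\<open>cycles_of_two_matching_disjoint\<close>), so the sets of one
  edge per cycle tried by the algorithm are \<open>k \<ge> 3\<close> disjoint sets, and by submodularity removing one of them
  loses at most the \<open>k\<close>-th part of the value (\<open>disjoint_removal_small_loss\<close>). At least two
  thirds survive, and adding the connecting edges does not decrease a monotone function.

  That a run can always be completed rests on one fact about graphs: a 2-matching without
  cycles consists of paths, which can be strung together to a tour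
  (\<open>acyclic_two_matching_extends_to_tour\<close>). It provides the connecting edges once each cycle is
  broken. It also shows that \<open>N\<close> has a cycle at all, so that its minimal cycle length makes
  sense: otherwise \<open>N\<close> would be properly contained in a tour, against its maximality.
\<close>

section \<open>Paths and cycles as edge sets\<close>

fun path_edges :: "'v list \<Rightarrow> 'v set set" where
  "path_edges [] = {}"
| "path_edges [x] = {}"
| "path_edges (x # y # zs) = insert {x, y} (path_edges (y # zs))"

lemma path_edges_append:
  assumes "xs \<noteq> []" "ys \<noteq> []"
  shows "path_edges (xs @ ys) = insert {last xs, hd ys} (path_edges xs \<union> path_edges ys)"
  using assms by (induction xs rule: path_edges.induct) (cases ys; auto)+

lemma path_edges_Cons:
  "ys \<noteq> [] \<Longrightarrow> path_edges (x # ys) = insert {x, hd ys} (path_edges ys)"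
  using path_edges_append[of "[x]" ys] by simp

lemma path_edges_rev: "path_edges (rev xs) = path_edges xs"
proof (induction xs)
  case (Cons x xs)
  show ?case
  proof (cases "xs = []")
    case False
    then show ?thesis
      using Cons by (simp add: path_edges_append path_edges_Cons last_rev insert_commute)
  qed simp
qed simp

lemma path_edges_subset_append:
  "path_edges xs \<union> path_edges ys \<subseteq> path_edges (xs @ ys)"
  by (cases "xs = []"; cases "ys = []") (auto simp: path_edges_append)

lemma path_edges_subset_concat:
  "xs \<in> set xss \<Longrightarrow> path_edges xs \<subseteq> path_edges (concat xss)"
proof (induction xss)
  case (Cons ys xss)
  then show ?case
    using path_edges_subset_append[of ys "concat xss"] by auto
qed simp

lemma path_edges_vertices: "e \<in> path_edges xs \<Longrightarrow> e \<subseteq> set xs"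
  by (induction xs rule: path_edges.induct) auto

lemma path_edges_nth: "path_edges xs = {{xs ! i, xs ! Suc i} | i. Suc i < length xs}"
proof (induction xs rule: path_edges.induct)
  case (3 x y zs)
  have "{{(x # y # zs) ! i, (x # y # zs) ! Suc i} | i. Suc i < length (x # y # zs)}
      = insert {x, y} {{(y # zs) ! i, (y # zs) ! Suc i} | i. Suc i < length (y # zs)}"
    (is "?L = insert _ ?R")
  proof (intro equalityI subsetI)
    fix e assume "e \<in> ?L"
    then obtain i where i: "e = {(x # y # zs) ! i, (x # y # zs) ! Suc i}"
      "Suc i < length (x # y # zs)" by blast
    show "e \<in> insert {x, y} ?R"
      using i by (cases i) auto
  next
    fix e assume "e \<in> insert {x, y} ?R"
    then consider "e = {x, y}" | i where "e = {(y # zs) ! i, (y # zs) ! Suc i}"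
      "Suc i < length (y # zs)" by blast
    then show "e \<in> ?L"
    proof cases
      case 1
      then have "e = {(x # y # zs) ! 0, (x # y # zs) ! Suc 0}
          \<and> Suc 0 < length (x # y # zs)" by simp
      then show ?thesis by blast
    next
      case 2
      then have "e = {(x # y # zs) ! Suc i, (x # y # zs) ! Suc (Suc i)}
          \<and> Suc (Suc i) < length (x # y # zs)" by simp
      then show ?thesis by blast
    qed
  qed
  with 3 show ?case by simp
qed auto

lemma closed_walk_edges_path:
  assumes "xs \<noteq> []"
  shows "closed_walk_edges xs = insert {last xs, hd xs} (path_edges xs)"
proof (intro equalityI subsetI)
  fix e assume "e \<in> closed_walk_edges xs"
  then obtain i where i: "i < length xs" "e = {xs ! i, xs ! (Suc i mod length xs)}"
    unfolding closed_walk_edges_def by blast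
  show "e \<in> insert {last xs, hd xs} (path_edges xs)"
  proof (cases "Suc i < length xs")
    case True
    with i show ?thesis unfolding path_edges_nth by auto
  next
    case False
    with i have "Suc i = length xs" by simp
    then have "i = length xs - 1" "Suc i mod length xs = 0" by auto
    with i assms show ?thesis by (simp add: last_conv_nth hd_conv_nth)
  qed
next
  fix e assume "e \<in> insert {last xs, hd xs} (path_edges xs)"
  then consider "e = {last xs, hd xs}" | i where "Suc i < length xs" "e = {xs ! i, xs ! Suc i}"
    unfolding path_edges_nth by blast
  then show "e \<in> closed_walk_edges xs"
  proof cases
    case 1
    have "Suc (length xs - 1) mod length xs = 0" "length xs - 1 < length xs"
      using assms by auto
    moreover have "e = {xs ! (length xs - 1), xs ! 0}"
      using 1 assms by (simp add: last_conv_nth hd_conv_nth)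
    ultimately show ?thesis
      unfolding closed_walk_edges_def by (intro CollectI exI[of _ "length xs - 1"]) simp
  next
    case 2
    then show ?thesis
      unfolding closed_walk_edges_def by (intro CollectI exI[of _ i]) simp
  qed
qed

text \<open>Rotation allows any chosen vertex of a cycle to be taken as the first one.\<close>

lemma closed_walk_edges_rotate:
  "closed_walk_edges (xs @ ys) = closed_walk_edges (ys @ xs)"
  by (cases "xs = []"; cases "ys = []")
     (auto simp: closed_walk_edges_path path_edges_append)

lemma finite_path_edges: "finite (path_edges xs)"
  by (induction xs rule: path_edges.induct) auto

lemma finite_closed_walk_edges: "finite (closed_walk_edges xs)"
  by (cases "xs = []") (auto simp: closed_walk_edges_path finite_path_edges closed_walk_edges_def)

lemma Union_closed_walk_edges: "\<Union> (closed_walk_edges xs) = set xs"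
proof -
  have "xs ! i \<in> \<Union> (closed_walk_edges xs)" if "i < length xs" for i
    using that unfolding closed_walk_edges_def by blast
  moreover have "\<Union> (closed_walk_edges xs) \<subseteq> set xs"
    by (cases "xs = []")
       (auto simp: closed_walk_edges_path closed_walk_edges_def dest: path_edges_vertices)
  ultimately show ?thesis by (auto simp: in_set_conv_nth)
qed

lemma card_path_edges: "distinct xs \<Longrightarrow> card (path_edges xs) = length xs - 1"
proof (induction xs rule: path_edges.induct)
  case (3 x y zs)
  have "{x, y} \<notin> path_edges (y # zs)"
    using 3(2) path_edges_vertices[of "{x, y}" "y # zs"] by auto
  with 3 show ?case by (simp add: finite_path_edges)
qed auto

lemma card_closed_walk_edges:
  assumes "distinct xs" "3 \<le> length xs"
  shows "card (closed_walk_edges xs) = length xs"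
proof -
  obtain x y zs where xs: "xs = x # y # zs" "zs \<noteq> []"
    using assms(2) by (cases xs rule: path_edges.cases) (auto simp: Suc_le_eq)
  have "last zs \<in> set zs" using xs by simp
  then have ne: "last zs \<noteq> y" "last zs \<noteq> x" using assms(1) xs by auto
  have "{last xs, hd xs} \<notin> path_edges xs"
    using ne assms(1) xs path_edges_vertices[of "{last zs, x}" "y # zs"]
    by (auto simp: doubleton_eq_iff)
  moreover have "card (path_edges xs) = length xs - 1" using assms(1) by (rule card_path_edges)
  ultimately show ?thesis
    using assms(2) xs closed_walk_edges_path[of xs]
    by (simp add: finite_path_edges del: path_edges.simps)
qed

lemma degree_closed_walk_edges:
  assumes "distinct xs" "3 \<le> length xs" "v \<in> set xs"
  shows "degree (closed_walk_edges xs) v = 2"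
proof -
  obtain as bs where xs: "xs = as @ v # bs" using assms(3) by (meson split_list)
  define ys where "ys = bs @ as"
  have len: "2 \<le> length ys" and dist: "distinct ys" "v \<notin> set ys"
    using assms xs by (auto simp: ys_def)
  then obtain y zs where ys: "ys = y # zs" "zs \<noteq> []"
    by (cases ys) (auto simp: Suc_le_eq)
  have "last zs \<in> set zs" using ys by simp
  then have ne: "last ys \<noteq> hd ys" using dist ys by auto
  have "closed_walk_edges xs = closed_walk_edges (v # ys)"
    using closed_walk_edges_rotate[of as "v # bs"] by (simp add: xs ys_def)
  also have "\<dots> = insert {last ys, v} (insert {v, hd ys} (path_edges ys))"
    using ys by (simp add: closed_walk_edges_path path_edges_Cons)
  finally have "{e \<in> closed_walk_edges xs. v \<in> e} = {{last ys, v}, {v, hd ys}}"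
    using dist path_edges_vertices[of _ ys] by auto
  moreover have "{last ys, v} \<noteq> {v, hd ys}"
    using ne by (auto simp: doubleton_eq_iff)
  ultimately show ?thesis by (simp add: degree_def)
qed

section \<open>Degrees and 2-matchings\<close>

lemma finite_complete_edges: "finite V \<Longrightarrow> finite (complete_edges V)"
  by (rule finite_subset[of _ "Pow V"]) (auto simp: complete_edges_def)

lemma degree_mono: "finite T \<Longrightarrow> S \<subseteq> T \<Longrightarrow> degree S v \<le> degree T v"
  unfolding degree_def by (rule card_mono) auto

lemma degree_insert:
  assumes "finite S" "e \<notin> S"
  shows "degree (insert e S) v = degree S v + (if v \<in> e then 1 else 0)"
proof -
  have "{d \<in> insert e S. v \<in> d} = (if v \<in> e then insert e {d \<in> S. v \<in> d} else {d \<in> S. v \<in> d})"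
    by auto
  then show ?thesis using assms by (simp add: degree_def)
qed

lemma two_matching_finite:
  assumes "finite V" "two_matching V S"
  shows "finite S"
proof -
  have "S \<subseteq> complete_edges V" using assms(2) by (simp add: two_matching_def)
  then show ?thesis using finite_complete_edges[OF assms(1)] by (rule finite_subset)
qed

lemma two_matching_empty: "two_matching V {}"
  by (simp add: two_matching_def degree_def)

lemma two_matching_subset:
  assumes "finite V" "two_matching V T" "S \<subseteq> T"
  shows "two_matching V S"
proof -
  have "degree S v \<le> degree T v" for v
    using two_matching_finite[OF assms(1,2)] assms(3) by (rule degree_mono)
  then have "degree S v \<le> 2" if "v \<in> V" for v
    using assms(2) that le_trans unfolding two_matching_def by blast
  then show ?thesis
    using assms(2,3) unfolding two_matching_def by blast
qed

lemma tours_two_matching: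
  assumes "T \<in> tours V"
  shows "two_matching V T" "is_cycle T" "card T = card V"
proof -
  obtain vs where vs: "distinct vs" "3 \<le> length vs" "set vs = V" "T = closed_walk_edges vs"
    using assms unfolding tours_def by blast
  have "e \<in> complete_edges V" if e: "e \<in> T" for e
  proof -
    obtain i where i: "i < length vs" "e = {vs ! i, vs ! (Suc i mod length vs)}"
      using e unfolding vs(4) closed_walk_edges_def by blast
    have ne: "Suc i mod length vs \<noteq> i"
      using i vs(2) by (cases "Suc i = length vs") auto
    have lt: "Suc i mod length vs < length vs" using i by (intro mod_less_divisor) linarith
    have "vs ! i \<noteq> vs ! (Suc i mod length vs)"
      using ne lt i(1) vs(1) by (metis nth_eq_iff_index_eq)
    moreover have "vs ! i \<in> V" "vs ! (Suc i mod length vs) \<in> V"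
      using lt i(1) vs(3) nth_mem by metis+
    ultimately show ?thesis
      using i(2) unfolding complete_edges_def by blast
  qed
  then show "two_matching V T"
    using vs degree_closed_walk_edges[OF vs(1,2)] by (auto simp: two_matching_def)
  show "is_cycle T" using vs unfolding is_cycle_def by blast
  show "card T = card V" using vs by (auto simp: card_closed_walk_edges distinct_card)
qed

lemma finite_tours: "finite V \<Longrightarrow> finite (tours V)"
  by (rule finite_subset[of _ "Pow (complete_edges V)"])
     (use tours_two_matching(1) in \<open>auto simp: two_matching_def finite_complete_edges\<close>)

section \<open>Acyclic 2-matchings extend to tours\<close>

text \<open>A linear forest presented by its paths. Isolated vertices are one-vertex lists, so that joining
  two components is always the concatenation of two lists, and concatenating all of them visits
  every vertex of \<open>V\<close> once.\<close>

definition path_cover :: "'v set \<Rightarrow> 'v set set \<Rightarrow> 'v list set \<Rightarrow> bool" where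
  "path_cover V P L \<longleftrightarrow> finite L \<and> (\<forall>xs\<in>L. xs \<noteq> [] \<and> distinct xs) \<and>
     (\<forall>xs\<in>L. \<forall>ys\<in>L. xs \<noteq> ys \<longrightarrow> set xs \<inter> set ys = {}) \<and>
     (\<Union>xs\<in>L. set xs) = V \<and> P = (\<Union>xs\<in>L. path_edges xs)"

lemma inner_vertex_degree:
  assumes "distinct xs" "u \<in> set xs" "path_edges xs \<subseteq> P" "finite P" "degree P u \<le> 1"
  shows "u = hd xs \<or> u = last xs"
proof (rule ccontr)
  assume neg: "\<not> ?thesis"
  obtain as bs where xs: "xs = as @ u # bs" using assms(2) by (meson split_list)
  have ne: "as \<noteq> []" "bs \<noteq> []" using neg xs by auto
  have "path_edges xs = insert {last as, u} (path_edges as \<union> insert {u, hd bs} (path_edges bs))"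
    using ne xs by (simp add: path_edges_append path_edges_Cons)
  then have "{{last as, u}, {u, hd bs}} \<subseteq> {e \<in> P. u \<in> e}" using assms(3) by auto
  then have "card {{last as, u}, {u, hd bs}} \<le> degree P u"
    unfolding degree_def using assms(4) by (intro card_mono) auto
  moreover have "last as \<in> set as" "hd bs \<in> set bs" using ne by auto
  then have "{last as, u} \<noteq> {u, hd bs}"
    using assms(1) xs by (auto simp: doubleton_eq_iff)
  ultimately show False using assms(5) by simp
qed

text \<open>Induction on the number of edges. Both ends of a new edge have degree at most 1 before it is
  added, so each is an end of its path. Were it the same path, the new edge would close it to a
  cycle; hence there are two paths, and after reversing them where necessary the edge joins the
  last vertex of one to the first vertex of the other.\<close>

lemma acyclic_two_matching_path_cover:
  assumes "finite V" "two_matching V P" "\<And>A. A \<subseteq> P \<Longrightarrow> \<not> is_cycle A"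
  shows "\<exists>L. path_cover V P L"
proof -
  have "finite P" using assms(1,2) by (rule two_matching_finite)
  then show ?thesis using assms(2,3)
  proof (induction P rule: finite_induct)
    case empty
    have "path_cover V {} ((\<lambda>v. [v]) ` V)"
      using assms(1) by (auto simp: path_cover_def)
    then show ?case ..
  next
    case (insert e P)
    have "two_matching V P"
      using two_matching_subset[OF assms(1) insert.prems(1)] by blast
    then obtain L where L: "path_cover V P L"
      using insert.IH insert.prems(2) by blast
    obtain u v where e: "e = {u, v}" "u \<noteq> v" "u \<in> V" "v \<in> V"
      using insert.prems(1) unfolding two_matching_def complete_edges_def by blast
    have deg: "degree P x \<le> 1" if "x \<in> e" for x
    proof -
      have "degree (insert e P) x \<le> 2"
        using insert.prems(1) that e unfolding two_matching_def by blast
      then show ?thesis using degree_insert[OF insert.hyps] that by simp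
    qed
    obtain xs ys where xs: "xs \<in> L" "u \<in> set xs" and ys: "ys \<in> L" "v \<in> set ys"
      using L e unfolding path_cover_def by blast
    have wf: "xs \<noteq> []" "ys \<noteq> []" "distinct xs" "distinct ys"
      and sub: "path_edges xs \<subseteq> P" "path_edges ys \<subseteq> P"
      using L xs ys unfolding path_cover_def by blast+
    have ends: "u = hd xs \<or> u = last xs" "v = hd ys \<or> v = last ys"
      using inner_vertex_degree[of xs u P] inner_vertex_degree[of ys v P]
        wf xs ys sub deg insert.hyps e by auto
    have "xs \<noteq> ys"
    proof
      assume eq: "xs = ys"
      have e': "e = {last xs, hd xs}" using ends e eq by auto
      \<comment> \<open>A path on one vertex would make the new edge a loop, one on two vertices an old edge.\<close>
      have "length xs \<noteq> 1" using e e' by (auto simp: length_Suc_conv)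
      moreover have "length xs \<noteq> 2"
      proof
        assume "length xs = 2"
        then obtain a b where "xs = [a, b]" by (auto simp: length_Suc_conv numeral_2_eq_2)
        then show False using e' sub insert.hyps by (auto simp: insert_commute)
      qed
      moreover have "length xs \<noteq> 0" using wf by simp
      ultimately have "3 \<le> length xs" by linarith
      then have "is_cycle (closed_walk_edges xs)" using wf unfolding is_cycle_def by blast
      moreover have "closed_walk_edges xs \<subseteq> insert e P"
        using closed_walk_edges_path[OF wf(1)] e' sub by auto
      ultimately show False using insert.prems(2) by blast
    qed
    define xs' where "xs' = (if u = last xs then xs else rev xs)"
    define ys' where "ys' = (if v = hd ys then ys else rev ys)"
    have xs': "set xs' = set xs" "distinct xs'" "xs' \<noteq> []" "path_edges xs' = path_edges xs"
        "last xs' = u"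
      using wf ends by (auto simp: xs'_def path_edges_rev last_rev)
    have ys': "set ys' = set ys" "distinct ys'" "ys' \<noteq> []" "path_edges ys' = path_edges ys"
        "hd ys' = v"
      using wf ends by (auto simp: ys'_def path_edges_rev hd_rev)
    have disj: "set xs \<inter> set ys = {}"
      using L xs ys \<open>xs \<noteq> ys\<close> unfolding path_cover_def by blast
    have disj': "set zs \<inter> set xs = {}" "set zs \<inter> set ys = {}" if "zs \<in> L - {xs, ys}" for zs
      using L xs ys that unfolding path_cover_def by blast+
    have split: "L = insert xs (insert ys (L - {xs, ys}))" using xs ys by blast
    define L' where "L' = insert (xs' @ ys') (L - {xs, ys})"
    have "(\<Union>zs\<in>L'. set zs) = (\<Union>zs\<in>insert xs (insert ys (L - {xs, ys})). set zs)"
      by (simp add: L'_def xs' ys' Un_assoc)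
    also have "\<dots> = V" using L split unfolding path_cover_def by metis
    finally have cov: "(\<Union>zs\<in>L'. set zs) = V" .
    have "(\<Union>zs\<in>L'. path_edges zs)
        = insert e (\<Union>zs\<in>insert xs (insert ys (L - {xs, ys})). path_edges zs)"
      by (simp add: L'_def xs' ys' path_edges_append e Un_assoc)
    also have "\<dots> = insert e P" using L split unfolding path_cover_def by metis
    finally have edg: "(\<Union>zs\<in>L'. path_edges zs) = insert e P" .
    have "path_cover V (insert e P) L'"
      unfolding path_cover_def
    proof (intro conjI)
      show "finite L'" using L by (auto simp: L'_def path_cover_def)
      show "\<forall>zs\<in>L'. zs \<noteq> [] \<and> distinct zs"
        using L xs' ys' disj by (auto simp: L'_def path_cover_def)
      show "\<forall>zs\<in>L'. \<forall>ws\<in>L'. zs \<noteq> ws \<longrightarrow> set zs \<inter> set ws = {}"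
      proof (intro ballI impI)
        fix zs ws assume *: "zs \<in> L'" "ws \<in> L'" "zs \<noteq> ws"
        have old: "set zs \<inter> set ws = {}" if "zs \<in> L" "ws \<in> L"
          using L * that unfolding path_cover_def by blast
        show "set zs \<inter> set ws = {}"
        proof (cases "zs = xs' @ ys'")
          case True
          then have "ws \<in> L - {xs, ys}" using * by (auto simp: L'_def)
          then show ?thesis using disj'[of ws] True xs' ys' by auto
        next
          case False
          then have z: "zs \<in> L - {xs, ys}" using * by (auto simp: L'_def)
          show ?thesis
          proof (cases "ws = xs' @ ys'")
            case True
            then show ?thesis using disj'[OF z] xs' ys' by auto
          next
            case False
            then show ?thesis using old z * by (auto simp: L'_def)
          qed
        qed
      qed
    qed (use cov edg in auto)
    then show ?case ..
  qed
qed

lemma acyclic_two_matching_extends_to_tour: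
  assumes "finite V" "3 \<le> card V" "two_matching V P" "\<And>A. A \<subseteq> P \<Longrightarrow> \<not> is_cycle A"
  obtains T where "T \<in> tours V" "P \<subseteq> T"
proof -
  obtain L where L: "path_cover V P L"
    using acyclic_two_matching_path_cover[OF assms(1,3,4)] by blast
  then obtain xss where xss: "set xss = L" "distinct xss"
    unfolding path_cover_def by (meson finite_distinct_list)
  define vs where "vs = concat xss"
  have vs: "distinct vs" "set vs = V"
    using L xss unfolding vs_def path_cover_def by (auto intro!: distinct_concat)
  then have len: "3 \<le> length vs" using assms(2) distinct_card by metis
  have "P \<subseteq> path_edges vs"
    using L xss path_edges_subset_concat unfolding path_cover_def vs_def by blast
  also have "\<dots> \<subseteq> closed_walk_edges vs" using len by (subst closed_walk_edges_path) auto
  finally show ?thesis using vs len that unfolding tours_def by blast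
qed

text \<open>Every vertex has degree 2 in a tour, so an edge of the tour outside \<open>P\<close> can only meet vertices
  that have degree at most 1 in \<open>P\<close>: the degree rule of the connection step holds for every tour
  that contains the paths.\<close>

lemma connects_to_tourI:
  assumes "finite V" "T \<in> tours V" "P \<subseteq> T"
  shows "connects_to_tour V P T"
proof -
  have T: "two_matching V T" "finite T"
    using assms tours_two_matching(1) two_matching_finite by blast+
  have "degree P v \<le> 1" if "e \<in> T - P" "v \<in> e" for e v
  proof -
    have "v \<in> V" using that T(1) unfolding two_matching_def complete_edges_def by blast
    then have "degree T v \<le> 2" using T(1) unfolding two_matching_def by blast
    moreover have "degree (insert e P) v \<le> degree T v"
      using that assms(3) T(2) by (intro degree_mono) auto
    moreover have "finite P" using T(2) assms(3) finite_subset by blast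
    ultimately show ?thesis using that degree_insert[of P e v] by auto
  qed
  then show ?thesis using assms unfolding connects_to_tour_def by blast
qed

section \<open>The cycles of a 2-matching\<close>

text \<open>An acyclic 2-matching is contained in a tour, which is itself a 2-matching. A maximal one would
  equal that tour and so be a cycle after all.\<close>

lemma maximal_two_matching_has_cycle:
  assumes "finite V" "3 \<le> card V" "two_matching V N"
    and max: "\<And>S. two_matching V S \<Longrightarrow> N \<subseteq> S \<Longrightarrow> S = N"
  shows "cycles_of N \<noteq> {}"
proof
  assume none: "cycles_of N = {}"
  then have "\<not> is_cycle A" if "A \<subseteq> N" for A
    using that unfolding cycles_of_def by blast
  then obtain T where T: "T \<in> tours V" "N \<subseteq> T"
    using acyclic_two_matching_extends_to_tour[OF assms(1-3)] by blast
  have "T = N" using max[OF tours_two_matching(1)[OF T(1)] T(2)] .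
  moreover have "is_cycle T" using T(1) by (rule tours_two_matching(2))
  ultimately show False using none unfolding cycles_of_def by blast
qed

lemma is_cycle_degree:
  assumes "is_cycle A"
  shows "finite A" "3 \<le> card A" "v \<in> \<Union>A \<Longrightarrow> degree A v = 2"
proof -
  obtain vs where vs: "distinct vs" "3 \<le> length vs" "A = closed_walk_edges vs"
    using assms unfolding is_cycle_def by blast
  show "finite A" "3 \<le> card A"
    using vs by (simp_all add: finite_closed_walk_edges card_closed_walk_edges)
  show "degree A v = 2" if "v \<in> \<Union>A"
    using that degree_closed_walk_edges[OF vs(1,2)] unfolding vs(3) Union_closed_walk_edges by blast
qed

text \<open>Each step of the walk uses an edge that touches \<open>A\<close>, hence an edge of \<open>A\<close>, and so ends on
  \<open>A\<close> again.\<close>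

lemma path_edges_stay:
  assumes "path_edges (v # ys) \<subseteq> N" "v \<in> \<Union>A"
    and sat: "\<And>e. e \<in> N \<Longrightarrow> e \<inter> \<Union>A \<noteq> {} \<Longrightarrow> e \<in> A"
  shows "path_edges (v # ys) \<subseteq> A"
  using assms(1,2)
proof (induction ys arbitrary: v)
  case (Cons y ys)
  have "{v, y} \<in> A" using Cons.prems by (intro sat) auto
  then show ?case using Cons.IH[of y] Cons.prems by auto
qed simp

lemma cycle_absorbed:
  assumes "is_cycle B" "B \<subseteq> N" "A \<inter> B \<noteq> {}" "{} \<notin> N"
    and sat: "\<And>e. e \<in> N \<Longrightarrow> e \<inter> \<Union>A \<noteq> {} \<Longrightarrow> e \<in> A"
  shows "B \<subseteq> A"
proof -
  obtain ws where ws: "B = closed_walk_edges ws"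
    using assms(1) unfolding is_cycle_def by blast
  obtain e where e: "e \<in> A" "e \<in> B" using assms(3) by blast
  then have "e \<noteq> {}" using assms(2,4) by blast
  then obtain v where v: "v \<in> \<Union>A" "v \<in> \<Union>B" using e by blast
  then have "v \<in> set ws" using ws by (simp add: Union_closed_walk_edges del: Union_iff)
  then obtain as bs where "ws = as @ v # bs" by (meson split_list)
  then have B: "B = closed_walk_edges (v # bs @ as)"
    using ws closed_walk_edges_rotate[of as "v # bs"] by simp
  then have B': "B = insert {last (v # bs @ as), v} (path_edges (v # bs @ as))"
    by (simp add: closed_walk_edges_path)
  have "path_edges (v # bs @ as) \<subseteq> A"
    using B' assms(2) v by (intro path_edges_stay[OF _ _ sat]) auto
  moreover have "{last (v # bs @ as), v} \<in> A"
    using B' assms(2) v by (intro sat) auto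
  ultimately show ?thesis using B' by blast
qed

text \<open>A cycle already uses up the two edges that a 2-matching allows at each of its vertices, so a
  second cycle sharing an edge with it is trapped in it, and conversely.\<close>

lemma cycles_of_two_matching_disjoint:
  assumes "finite V" "two_matching V N" "A \<in> cycles_of N" "B \<in> cycles_of N" "A \<inter> B \<noteq> {}"
  shows "A = B"
proof -
  have sat: "e \<in> D" if D: "D \<in> cycles_of N" and e: "e \<in> N" "e \<inter> \<Union>D \<noteq> {}" for D e
  proof -
    obtain v where v: "v \<in> e" "v \<in> \<Union>D" using e by blast
    have "v \<in> V"
      using v e assms(2) unfolding two_matching_def complete_edges_def by blast
    then have "degree N v \<le> 2" using assms(2) unfolding two_matching_def by blast
    also have "2 = degree D v"
      using is_cycle_degree(3)[of D v] D v unfolding cycles_of_def by simp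
    finally have "{d \<in> D. v \<in> d} = {d \<in> N. v \<in> d}"
      using D two_matching_finite[OF assms(1,2)]
      unfolding degree_def cycles_of_def by (intro card_seteq) auto
    then show ?thesis using v e by blast
  qed
  have ne: "{} \<notin> N" using assms(2) unfolding two_matching_def complete_edges_def by blast
  have absorb: "C \<subseteq> D" if "C \<in> cycles_of N" "D \<in> cycles_of N" "D \<inter> C \<noteq> {}" for C D
    using that(1) by (intro cycle_absorbed[OF _ _ that(3) ne sat[OF that(2)]])
      (auto simp: cycles_of_def)
  show ?thesis using absorb[of A B] absorb[of B A] assms(3-5) by blast
qed

section \<open>Greedy 2-matchings for submodular functions\<close>

lemma submodular_onD:
  "submodular_on E g \<Longrightarrow> S \<subseteq> E \<Longrightarrow> T \<subseteq> E \<Longrightarrow> g (S \<union> T) + g (S \<inter> T) \<le> g S + g T"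
  unfolding submodular_on_def by blast

lemma submodular_add_set:
  assumes "submodular_on E g" "S \<subseteq> E" "finite X" "X \<subseteq> E"
    and gain: "\<And>x. x \<in> X \<Longrightarrow> g (insert x S) - g S \<le> m" and "0 \<le> m"
  shows "g (S \<union> X) - g S \<le> real (card X) * m"
  using assms(3,4) gain
proof (induction X rule: finite_induct)
  case (insert x X)
  have IH: "g (S \<union> X) - g S \<le> real (card X) * m" using insert by auto
  have x: "g (insert x S) - g S \<le> m" using insert.prems by blast
  show ?case
  proof (cases "x \<in> S")
    case True
    then have "S \<union> insert x X = S \<union> X" by blast
    then show ?thesis using IH insert.hyps assms(6) by (simp add: algebra_simps)
  next
    case False
    have "(S \<union> X) \<union> insert x S = S \<union> insert x X" "(S \<union> X) \<inter> insert x S = S"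
      using insert.hyps False by auto
    then have "g (S \<union> insert x X) + g S \<le> g (S \<union> X) + g (insert x S)"
      using submodular_onD[OF assms(1), of "S \<union> X" "insert x S"] assms(2) insert.prems by simp
    then show ?thesis using IH x insert.hyps by (simp add: algebra_simps)
  qed
qed simp

text \<open>Diminishing returns, twice: deleting \<open>X\<close> from the larger set \<open>S \<union> R\<close> costs at most what adding
  \<open>X\<close> to the smaller set \<open>S\<close> gains, and that is at most the sum of the single gains.\<close>

lemma submodular_remove_set:
  assumes "submodular_on E g" "S \<subseteq> E" "R \<subseteq> E" "finite X" "X \<subseteq> R" "R \<inter> S = {}"
    and gain: "\<And>x. x \<in> X \<Longrightarrow> g (insert x S) - g S \<le> m" and "0 \<le> m"
  shows "g (S \<union> R) - g (S \<union> (R - X)) \<le> real (card X) * m"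
proof -
  have "(S \<union> (R - X)) \<union> (S \<union> X) = S \<union> R" "(S \<union> (R - X)) \<inter> (S \<union> X) = S"
    using assms(5) by auto
  then have "g (S \<union> R) + g S \<le> g (S \<union> (R - X)) + g (S \<union> X)"
    using submodular_onD[OF assms(1), of "S \<union> (R - X)" "S \<union> X"] assms(2,3,5)
    by (auto simp: subset_iff)
  moreover have "g (S \<union> X) - g S \<le> real (card X) * m"
    using assms by (intro submodular_add_set[where E = E]) auto
  ultimately show ?thesis by linarith
qed

lemma greedy_run_basic:
  assumes "greedy_run V g C S"
  shows "S \<subseteq> C \<and> C \<subseteq> complete_edges V"
  using assms by induction auto

text \<open>An edge was rejected because one of its ends was saturated, and degrees only grow afterwards.\<close>

lemma greedy_run_maximal:
  assumes "greedy_run V g C S" "finite V" "e \<in> C - S"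
  shows "\<exists>v\<in>e. 2 \<le> degree S v"
  using assms
proof (induction arbitrary: e)
  case (step C S d)
  have fin: "finite (insert d S)"
    using greedy_run_basic[OF step.hyps(1)] finite_complete_edges[OF step.prems(1)]
    by (meson finite_insert finite_subset)
  let ?S = "if \<forall>v\<in>d. degree S v < 2 then insert d S else S"
  have mono: "degree S v \<le> degree ?S v" for v
    using degree_mono[OF fin, of S v] by auto
  show ?case
  proof (cases "e = d")
    case True
    then show ?thesis using step.prems by (auto simp: not_less split: if_splits)
  next
    case False
    then have "e \<in> C - S" using step.prems by (auto split: if_splits)
    then obtain v where "v \<in> e" "2 \<le> degree S v" using step.IH[OF step.prems(1)] by blast
    then show ?thesis using mono[of v] by (meson order_trans)
  qed
qed simp

lemma free_degree_by_removing_edge: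
  assumes "finite (S \<union> R)" "degree S v < 2" "degree (S \<union> R) v \<le> 2"
  obtains Y where "Y \<subseteq> R" "card Y \<le> 1" "finite Y" "degree (S \<union> (R - Y)) v \<le> 1"
proof (cases "degree (S \<union> R) v \<le> 1")
  case True
  then show ?thesis using that[of "{}"] by simp
next
  case False
  then have "\<not> card {e \<in> S \<union> R. v \<in> e} \<le> card {e \<in> S. v \<in> e}"
    using assms(2) unfolding degree_def by linarith
  then have "\<not> {e \<in> S \<union> R. v \<in> e} \<subseteq> {e \<in> S. v \<in> e}"
    using assms(1) card_mono[of "{e \<in> S. v \<in> e}" "{e \<in> S \<union> R. v \<in> e}"] by auto
  then obtain r where r: "r \<in> R - S" "v \<in> r" by blast
  then have "S \<union> R = insert r (S \<union> (R - {r}))" "r \<notin> S \<union> (R - {r})" by auto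
  then have "degree (S \<union> R) v = degree (S \<union> (R - {r})) v + 1"
    using degree_insert[of "S \<union> (R - {r})" r v] assms(1) r by simp
  then show ?thesis using that[of "{r}"] assms(3) r by simp
qed

text \<open>The exchange property behind the factor 3: an edge has two ends, and at each end at most one
  edge of \<open>R\<close> has to make way for it.\<close>

lemma exchange_for_edge:
  assumes "finite V" "two_matching V (S \<union> R)" "e \<in> complete_edges V" "e \<notin> S \<union> R"
    and free: "\<And>v. v \<in> e \<Longrightarrow> degree S v < 2"
  obtains X where "X \<subseteq> R" "finite X" "card X \<le> 2" "two_matching V (insert e (S \<union> (R - X)))"
proof -
  obtain a b where e: "e = {a, b}" "a \<in> V" "b \<in> V"
    using assms(3) unfolding complete_edges_def by blast
  have fin: "finite (S \<union> R)" using two_matching_finite[OF assms(1,2)] .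
  have deg2: "degree (S \<union> R) v \<le> 2" if "v \<in> V" for v
    using assms(2) that unfolding two_matching_def by blast
  obtain Y where Y: "Y \<subseteq> R" "card Y \<le> 1" "finite Y" "degree (S \<union> (R - Y)) a \<le> 1"
    using free_degree_by_removing_edge[OF fin free[of a] deg2[of a]] e by blast
  obtain Z where Z: "Z \<subseteq> R" "card Z \<le> 1" "finite Z" "degree (S \<union> (R - Z)) b \<le> 1"
    using free_degree_by_removing_edge[OF fin free[of b] deg2[of b]] e by blast
  define X where "X = Y \<union> Z"
  let ?T = "S \<union> (R - X)"
  have le: "degree ?T v \<le> degree (S \<union> (R - Y)) v" "degree ?T v \<le> degree (S \<union> (R - Z)) v"
    "degree ?T v \<le> degree (S \<union> R) v" for v
    by (intro degree_mono; use fin in \<open>auto simp: X_def\<close>)+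
  have "degree (insert e ?T) v \<le> 2" if "v \<in> V" for v
  proof -
    have "degree (insert e ?T) v = degree ?T v + (if v \<in> e then 1 else 0)"
      using fin assms(4) by (intro degree_insert) auto
    then show ?thesis
      using le[of v] deg2[OF that] Y(4) Z(4) e by auto
  qed
  then have "two_matching V (insert e ?T)"
    using assms(2,3) unfolding two_matching_def by blast
  moreover have "card X \<le> 2" using card_Un_le[of Y Z] Y Z by (simp add: X_def)
  ultimately show ?thesis using that[of X] Y Z by (simp add: X_def)
qed

text \<open>\<open>R\<close> is what remains of the comparison solution: edges not yet considered that can still all be
  added to \<open>S\<close>. Initially it is the comparison solution itself. A rejected edge cannot lie in
  \<open>R\<close>. When an edge \<open>e\<close> outside \<open>R\<close> is accepted, at most two edges leave \<open>R\<close>; each was available when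
  the greedy rule preferred \<open>e\<close>, so its loss is at most the gain of \<open>e\<close>, which pays for the term
  with factor 2. At the end no edge is left to consider and \<open>R\<close> is empty.\<close>

lemma greedy_run_invariant:
  assumes "finite V" "submodular_on (complete_edges V) g" "mono_on (Pow (complete_edges V)) g"
    and opt: "two_matching V Opt"
    and "greedy_run V g C S"
  shows "\<exists>R \<subseteq> complete_edges V - C. two_matching V (S \<union> R) \<and>
    g Opt \<le> g (S \<union> R) + 2 * (g S - g {})"
  using assms(5)
proof induction
  case start
  then show ?case using opt unfolding two_matching_def by (intro exI[of _ Opt]) auto
next
  case (step C S e)
  let ?E = "complete_edges V"
  obtain R where R: "R \<subseteq> ?E - C" "two_matching V (S \<union> R)"
    "g Opt \<le> g (S \<union> R) + 2 * (g S - g {})"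
    using step.IH by blast
  have SC: "S \<subseteq> C" "C \<subseteq> ?E" using greedy_run_basic[OF step.hyps(1)] by auto
  have e: "e \<in> ?E" "e \<notin> C" using step.hyps(2) by auto
  define m where "m = g (insert e S) - g S"
  have gain: "g (insert x S) - g S \<le> m" if "x \<in> ?E - C" for x
    using step.hyps(3) that by (auto simp: m_def)
  have mono: "g A \<le> g B" if "A \<subseteq> B" "B \<subseteq> ?E" for A B
    using assms(3) that by (auto intro: mono_onD)
  have m: "0 \<le> m" using mono[of S "insert e S"] SC e by (auto simp: m_def)
  show ?case
  proof (cases "\<forall>v\<in>e. degree S v < 2")
    case False
    have "e \<notin> R"
    proof
      assume "e \<in> R"
      have fin: "finite (S \<union> R)" using two_matching_finite[OF assms(1) R(2)] .
      obtain v where v: "v \<in> e" "2 \<le> degree S v" using False by (auto simp: not_less)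
      have "degree (insert e S) v = degree S v + 1"
        using degree_insert[of S e v] fin SC e v by auto
      moreover have "degree (insert e S) v \<le> degree (S \<union> R) v"
        using fin \<open>e \<in> R\<close> by (intro degree_mono) auto
      moreover have "v \<in> V" using v(1) e unfolding complete_edges_def by blast
      then have "degree (S \<union> R) v \<le> 2" using R(2) unfolding two_matching_def by blast
      ultimately show False using v by linarith
    qed
    then have "R \<subseteq> ?E - insert e C" using R(1) by blast
    moreover have ifS: "(if \<forall>v\<in>e. degree S v < 2 then insert e S else S) = S"
      using False by (rule if_not_P)
    ultimately show ?thesis unfolding ifS using R(2,3) by blast
  next
    case True
    have ifS: "(if \<forall>v\<in>e. degree S v < 2 then insert e S else S) = insert e S"
      using True by (rule if_P)
    have "\<exists>R' \<subseteq> ?E - insert e C. two_matching V (insert e S \<union> R') \<and>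
      g (S \<union> R) \<le> g (insert e S \<union> R') + 2 * m"
    proof (cases "e \<in> R")
      case True
      then have "insert e S \<union> (R - {e}) = S \<union> R" by blast
      then show ?thesis using R m by (intro exI[of _ "R - {e}"]) auto
    next
      case False
      then obtain X where X: "X \<subseteq> R" "finite X" "card X \<le> 2"
        "two_matching V (insert e (S \<union> (R - X)))"
        using exchange_for_edge[OF assms(1) R(2) e(1)] SC e True by blast
      have "g (S \<union> R) - g (S \<union> (R - X)) \<le> real (card X) * m"
        using R(1) SC X gain m
        by (intro submodular_remove_set[OF assms(2)]) auto
      also have "\<dots> \<le> 2 * m" using X(3) m by (intro mult_right_mono) auto
      finally have "g (S \<union> R) - g (S \<union> (R - X)) \<le> 2 * m" .
      moreover have "g (S \<union> (R - X)) \<le> g (insert e S \<union> (R - X))"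
        using R(1) SC e by (intro mono) auto
      ultimately show ?thesis
        using X(4) R(1) False by (intro exI[of _ "R - X"]) auto
    qed
    then obtain R' where "R' \<subseteq> ?E - insert e C" "two_matching V (insert e S \<union> R')"
      "g (S \<union> R) \<le> g (insert e S \<union> R') + 2 * m" by blast
    moreover have "g Opt \<le> g (insert e S \<union> R') + 2 * (g (insert e S) - g {})"
      using calculation(3) R(3) by (simp add: m_def)
    ultimately show ?thesis unfolding ifS by blast
  qed
qed

lemma greedy_two_matching_is_maximal:
  assumes "finite V" "greedy_two_matching V g S" "two_matching V T" "S \<subseteq> T"
  shows "T = S"
proof (rule ccontr)
  assume "T \<noteq> S"
  then obtain e where e: "e \<in> T - S" using assms(4) by blast
  have E: "e \<in> complete_edges V" using e assms(3) unfolding two_matching_def by blast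
  obtain v where v: "v \<in> e" "2 \<le> degree S v"
    using greedy_run_maximal[OF _ assms(1)] assms(2) e E unfolding greedy_two_matching_def by blast
  have fin: "finite T" using two_matching_finite[OF assms(1,3)] .
  have "degree (insert e S) v = degree S v + 1"
    using degree_insert[of S e v] e v finite_subset[OF assms(4) fin] by simp
  moreover have "degree (insert e S) v \<le> degree T v"
    using fin e assms(4) by (intro degree_mono) auto
  moreover have "v \<in> V" using v(1) E unfolding complete_edges_def by blast
  then have "degree T v \<le> 2" using assms(3) unfolding two_matching_def by blast
  ultimately show False using v by linarith
qed

lemma greedy_two_matching_approximation:
  assumes "finite V" "submodular_on (complete_edges V) g" "mono_on (Pow (complete_edges V)) g"
    and "0 \<le> g {}" "greedy_two_matching V g S" "two_matching V Opt"
  shows "two_matching V S" "g Opt \<le> 3 * g S"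
proof -
  have "greedy_run V g (complete_edges V) S"
    using assms(5) unfolding greedy_two_matching_def .
  from greedy_run_invariant[OF assms(1-3,6) this]
  have "two_matching V S \<and> g Opt \<le> g S + 2 * (g S - g {})" by auto
  then show "two_matching V S" "g Opt \<le> 3 * g S" using assms(4) by auto
qed

lemma greedy_two_matching_exists:
  assumes "finite V"
  shows "\<exists>S. greedy_two_matching V g S"
proof -
  let ?E = "complete_edges V"
  have finE: "finite ?E" using assms by (rule finite_complete_edges)
  define \<C> where "\<C> = {C. \<exists>S. greedy_run V g C S}"
  have "\<C> \<subseteq> Pow ?E" using greedy_run_basic unfolding \<C>_def by blast
  then have "finite \<C>" using finE finite_subset by blast
  moreover have "{} \<in> \<C>" using greedy_run.start unfolding \<C>_def by blast
  ultimately obtain C where C: "C \<in> \<C>" "\<And>D. D \<in> \<C> \<Longrightarrow> C \<subseteq> D \<Longrightarrow> C = D"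
    using finite_has_maximal2[of \<C> "{}"] by auto
  then obtain S where S: "greedy_run V g C S" unfolding \<C>_def by blast
  have "?E - C = {}"
  proof (rule ccontr)
    assume ne: "?E - C \<noteq> {}"
    define h where "h e = g (S \<union> {e}) - g S" for e
    have fin: "finite (h ` (?E - C))" using finE by blast
    then have "Max (h ` (?E - C)) \<in> h ` (?E - C)" using ne by (intro Max_in) auto
    then obtain e where e: "e \<in> ?E - C" "h e = Max (h ` (?E - C))" by auto
    then have "\<forall>d\<in>?E - C. h d \<le> h e" using fin by simp
    then have "insert e C \<in> \<C>"
      using greedy_run.step[OF S e(1)] unfolding \<C>_def h_def by blast
    then show False using C(2)[of "insert e C"] e(1) by blast
  qed
  then have "C = ?E" using greedy_run_basic[OF S] by blast
  then show ?thesis using S unfolding greedy_two_matching_def by blast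
qed

text \<open>With nonnegative weights a superset of a heaviest 2-matching is again heaviest, so an
  inclusion-maximal one among the heaviest is inclusion-maximal among all 2-matchings.\<close>

lemma max_weight_two_matching_exists:
  assumes "finite V" and nonneg: "\<And>e. e \<in> complete_edges V \<Longrightarrow> 0 \<le> wt e"
  shows "\<exists>S. max_weight_two_matching V wt S"
proof -
  let ?W = "\<lambda>S. \<Sum>e\<in>S. (wt e :: real)"
  define \<M> where "\<M> = {S. two_matching V S}"
  have "\<M> \<subseteq> Pow (complete_edges V)" by (auto simp: \<M>_def two_matching_def)
  then have fin: "finite \<M>" using finite_complete_edges[OF assms(1)] finite_subset by blast
  have "{} \<in> \<M>" by (simp add: \<M>_def two_matching_empty)
  then have max: "Max (?W ` \<M>) \<in> ?W ` \<M>" using fin by (intro Max_in) auto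
  have ub: "?W S \<le> Max (?W ` \<M>)" if "S \<in> \<M>" for S using fin that by simp
  define \<O> where "\<O> = {S \<in> \<M>. ?W S = Max (?W ` \<M>)}"
  have "finite \<O>" "\<O> \<noteq> {}" using fin max unfolding \<O>_def by auto
  then obtain S where S: "S \<in> \<O>" "\<And>T. T \<in> \<O> \<Longrightarrow> S \<subseteq> T \<Longrightarrow> S = T"
    using finite_has_maximal[of \<O>] by blast
  have "T = S" if T: "two_matching V T" "S \<subseteq> T" for T
  proof -
    have "?W S \<le> ?W T"
      using T nonneg two_matching_finite[OF assms(1) T(1)]
      by (intro sum_mono2) (auto simp: two_matching_def)
    moreover have "T \<in> \<M>" using T by (simp add: \<M>_def)
    ultimately have "T \<in> \<O>" using S(1) ub[of T] unfolding \<O>_def by auto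
    then show ?thesis using S(2) T by blast
  qed
  then have "max_weight_two_matching V wt S"
    using S(1) ub unfolding max_weight_two_matching_def \<O>_def \<M>_def by auto
  then show ?thesis ..
qed

section \<open>Breaking the cycles\<close>

text \<open>Removing a set from \<open>N\<close> costs no more than removing it after other sets have already been
  removed, so the separate losses are bounded by the telescoping loss of removing all of them.\<close>

lemma submodular_removal_losses:
  assumes "submodular_on E g" "N \<subseteq> E" "finite I"
    and "\<And>i. i \<in> I \<Longrightarrow> U i \<subseteq> N"
    and "\<And>i j. i \<in> I \<Longrightarrow> j \<in> I \<Longrightarrow> i \<noteq> j \<Longrightarrow> U i \<inter> U j = {}"
  shows "(\<Sum>i\<in>I. g N - g (N - U i)) \<le> g N - g (N - (\<Union>i\<in>I. U i))"
  using assms(3-5)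
proof (induction I rule: finite_induct)
  case (insert j I)
  let ?W = "\<Union>i\<in>I. U i"
  have disj: "U j \<inter> ?W = {}" using insert.prems(2) insert.hyps by fastforce
  have "(N - ?W) \<union> (N - U j) = N"
    "(N - ?W) \<inter> (N - U j) = N - (\<Union>i\<in>insert j I. U i)"
    using disj by auto
  then have "g N + g (N - (\<Union>i\<in>insert j I. U i)) \<le> g (N - ?W) + g (N - U j)"
    using submodular_onD[OF assms(1), of "N - ?W" "N - U j"] assms(2)
    by (metis Diff_subset order_trans)
  moreover have "(\<Sum>i\<in>I. g N - g (N - U i)) \<le> g N - g (N - ?W)"
    using insert by auto
  ultimately show ?case using insert.hyps by simp
qed simp

text \<open>By averaging: the \<open>k\<close> losses add up to at most \<open>g N\<close>, hence one of them is at most the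
  \<open>k\<close>-th part of it.\<close>

lemma disjoint_removal_small_loss:
  assumes "submodular_on E g" "N \<subseteq> E" "\<And>S. S \<subseteq> E \<Longrightarrow> 0 \<le> g S" "0 < (k::nat)"
    and "\<And>i. i \<in> {1..k} \<Longrightarrow> U i \<subseteq> N"
    and "\<And>i j. i \<in> {1..k} \<Longrightarrow> j \<in> {1..k} \<Longrightarrow> i \<noteq> j \<Longrightarrow> U i \<inter> U j = {}"
  shows "\<exists>i\<in>{1..k}. (real k - 1) / real k * g N \<le> g (N - U i)"
proof (rule ccontr)
  assume "\<not> ?thesis"
  then have "g N / real k < g N - g (N - U i)" if "i \<in> {1..k}" for i
    using that assms(4) by (force simp: field_simps not_le)
  then have "(\<Sum>i\<in>{1..k}. g N / real k) < (\<Sum>i\<in>{1..k}. g N - g (N - U i))"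
    using assms(4) by (intro sum_strict_mono) auto
  also have "\<dots> \<le> g N - g (N - (\<Union>i\<in>{1..k}. U i))"
    using assms by (intro submodular_removal_losses) auto
  also have "\<dots> \<le> g N" using assms(3)[of "N - (\<Union>i\<in>{1..k}. U i)"] assms(2) by auto
  finally show False using assms(4) by simp
qed

lemma min_cycle_length_bounds:
  assumes "finite V" "two_matching V N" "cycles_of N \<noteq> {}"
  shows "3 \<le> min_cycle_length N" "A \<in> cycles_of N \<Longrightarrow> min_cycle_length N \<le> card A"
proof -
  have "cycles_of N \<subseteq> Pow N" unfolding cycles_of_def by blast
  then have fin: "finite (cycles_of N)"
    using two_matching_finite[OF assms(1,2)] finite_subset by blast
  show "3 \<le> min_cycle_length N"
    unfolding min_cycle_length_def using fin assms(3) is_cycle_degree(2)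
    by (auto simp: cycles_of_def)
  show "min_cycle_length N \<le> card A" if "A \<in> cycles_of N"
    unfolding min_cycle_length_def using fin that by simp
qed

lemma cycle_enumeration_exists:
  assumes "finite N"
  shows "\<exists>a. cycle_enumeration N a"
proof -
  have "\<exists>h. bij_betw h {1..card A} A" if "A \<in> cycles_of N" for A
    using that assms finite_subset ex_bij_betw_nat_finite_1 unfolding cycles_of_def by blast
  then show ?thesis unfolding cycle_enumeration_def by metis
qed

lemma cycle_edge_in_cycle:
  assumes "finite V" "two_matching V N" "cycle_enumeration N a"
    and "A \<in> cycles_of N" "i \<in> {1..min_cycle_length N}"
  shows "a A i \<in> A"
proof -
  have "i \<in> {1..card A}"
    using min_cycle_length_bounds(2)[OF assms(1,2) _ assms(4)] assms(4,5) by fastforce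
  then show ?thesis using assms(3,4) bij_betwE unfolding cycle_enumeration_def by blast
qed

lemma removed_edges_disjoint:
  assumes "finite V" "two_matching V N" "cycle_enumeration N a"
    and ij: "i \<in> {1..min_cycle_length N}" "j \<in> {1..min_cycle_length N}" "i \<noteq> j"
  shows "removed_edges N a i \<inter> removed_edges N a j = {}"
proof (rule ccontr)
  assume "\<not> ?thesis"
  then obtain A B where AB: "A \<in> cycles_of N" "B \<in> cycles_of N" "a A i = a B j"
    unfolding removed_edges_def by blast
  have "a A i \<in> A" "a B j \<in> B"
    using cycle_edge_in_cycle[OF assms(1-3)] AB ij by blast+
  then have "A = B"
    using cycles_of_two_matching_disjoint[OF assms(1,2)] AB by fastforce
  moreover have "inj_on (a A) {1..card A}"
    using assms(3) AB(1) unfolding cycle_enumeration_def bij_betw_def by blast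
  moreover have "min_cycle_length N \<le> card A"
    using min_cycle_length_bounds(2)[OF assms(1,2)] AB(1) by blast
  ultimately show False using AB(3) ij by (auto dest: inj_onD)
qed

lemma removal_breaks_cycles:
  assumes "finite V" "two_matching V N" "cycle_enumeration N a"
    and "i \<in> {1..min_cycle_length N}" "A \<subseteq> N - removed_edges N a i"
  shows "\<not> is_cycle A"
proof
  assume "is_cycle A"
  then have A: "A \<in> cycles_of N" using assms(5) unfolding cycles_of_def by blast
  then have "a A i \<in> A" using cycle_edge_in_cycle[OF assms(1-3) _ assms(4)] by blast
  moreover have "a A i \<in> removed_edges N a i" using A unfolding removed_edges_def by blast
  ultimately show False using assms(5) by blast
qed

lemma stopping_index_exists:
  assumes "finite V" "two_matching V N" "cycles_of N \<noteq> {}" "cycle_enumeration N a"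
    and "submodular_on (complete_edges V) g" "\<And>S. S \<subseteq> complete_edges V \<Longrightarrow> 0 \<le> g S"
  shows "\<exists>i. stopping_index g N a i"
proof -
  let ?k = "min_cycle_length N"
  have "removed_edges N a i \<subseteq> N" if "i \<in> {1..?k}" for i
    using cycle_edge_in_cycle[OF assms(1,2,4) _ that]
    unfolding removed_edges_def cycles_of_def by blast
  moreover have "N \<subseteq> complete_edges V" using assms(2) by (simp add: two_matching_def)
  moreover have "0 < ?k" using min_cycle_length_bounds(1)[OF assms(1-3)] by simp
  ultimately have "\<exists>i\<in>{1..?k}. good_index g N a i"
    unfolding good_index_def
    using removed_edges_disjoint[OF assms(1,2,4)] assms(5,6)
    by (intro disjoint_removal_small_loss[where E = "complete_edges V"]) auto
  then obtain i where i: "i \<in> {1..?k} \<and> good_index g N a i" by blast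
  define l where "l = (LEAST i. i \<in> {1..?k} \<and> good_index g N a i)"
  have l: "l \<in> {1..?k} \<and> good_index g N a l" unfolding l_def using i by (rule LeastI)
  have "\<not> good_index g N a j" if "j \<in> {1..<l}" for j
    using not_less_Least[of j "\<lambda>i. i \<in> {1..?k} \<and> good_index g N a i"] that l
    unfolding l_def[symmetric] by auto
  then show ?thesis using l unfolding stopping_index_def by blast
qed

section \<open>The modified objective\<close>

lemma modified_objective_sum:
  assumes "finite S"
  shows "modified_objective \<beta> w c M S = (1 - \<beta>) * w S + \<beta> * (\<Sum>e\<in>S. M - c e)"
  using assms by (simp add: modified_objective_def objective_def sum_subtractf algebra_simps)

text \<open>By the previous lemma the modified objective is a convex combination of \<open>w\<close> and of an
  additive function whose weights \<open>M - c e\<close> are nonnegative; both summands have all three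
  properties.\<close>

lemma modified_objective_properties:
  assumes "finite E" "\<And>S. S \<subseteq> E \<Longrightarrow> 0 \<le> w S" "mono_on (Pow E) w" "submodular_on E w"
    and cM: "\<And>e. e \<in> E \<Longrightarrow> c e \<le> M" and \<beta>: "0 \<le> \<beta>" "\<beta> \<le> 1"
  defines "g \<equiv> modified_objective \<beta> w c M"
  shows "\<And>S. S \<subseteq> E \<Longrightarrow> 0 \<le> g S" "mono_on (Pow E) g" "submodular_on E g"
proof -
  let ?p = "\<lambda>S. \<Sum>e\<in>S. M - c e"
  have fin: "finite S" if "S \<subseteq> E" for S using assms(1) that finite_subset by blast
  have g: "g S = (1 - \<beta>) * w S + \<beta> * ?p S" if "S \<subseteq> E" for S
    unfolding g_def by (rule modified_objective_sum[OF fin[OF that]])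
  show "0 \<le> g S" if "S \<subseteq> E" for S
  proof -
    have "0 \<le> ?p S" using that cM by (intro sum_nonneg) auto
    then show ?thesis using assms(2)[OF that] \<beta> g[OF that] by simp
  qed
  show "mono_on (Pow E) g"
  proof (rule mono_onI)
    fix S T assume ST: "S \<in> Pow E" "T \<in> Pow E" "S \<subseteq> T"
    have "w S \<le> w T" using ST assms(3) by (auto intro: mono_onD)
    moreover have "?p S \<le> ?p T" using ST fin[of T] cM by (intro sum_mono2) auto
    ultimately have "(1 - \<beta>) * w S + \<beta> * ?p S \<le> (1 - \<beta>) * w T + \<beta> * ?p T"
      using \<beta> by (intro add_mono mult_left_mono) auto
    then show "g S \<le> g T" using ST g by simp
  qed
  show "submodular_on E g"
    unfolding submodular_on_def
  proof (intro allI impI)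
    fix S T assume ST: "S \<subseteq> E" "T \<subseteq> E"
    have "?p (S \<union> T) + ?p (S \<inter> T) = ?p S + ?p T" using ST fin by (intro sum.union_inter) auto
    then have "\<beta> * ?p (S \<union> T) + \<beta> * ?p (S \<inter> T) = \<beta> * ?p S + \<beta> * ?p T"
      by (metis distrib_left)
    moreover have "(1 - \<beta>) * (w (S \<union> T) + w (S \<inter> T)) \<le> (1 - \<beta>) * (w S + w T)"
      using submodular_onD[OF assms(4) ST] \<beta> by (intro mult_left_mono) auto
    moreover have "S \<union> T \<subseteq> E" "S \<inter> T \<subseteq> E" using ST by auto
    ultimately show "g (S \<union> T) + g (S \<inter> T) \<le> g S + g T"
      using g[of S] g[of T] g[of "S \<union> T"] g[of "S \<inter> T"] ST by (simp add: distrib_left)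
  qed
qed

section \<open>The approximation guarantee\<close>

lemma initial_two_matching_properties:
  assumes "finite V" "3 \<le> card V" "initial_two_matching V g N"
    and "submodular_on (complete_edges V) g" "mono_on (Pow (complete_edges V)) g" "0 \<le> g {}"
  shows "two_matching V N" "cycles_of N \<noteq> {}" "two_matching V Opt \<Longrightarrow> g Opt \<le> 3 * g N"
proof -
  obtain M1 M2 where M: "greedy_two_matching V g M1"
    "max_weight_two_matching V (\<lambda>e. g {e}) M2" "N \<in> {M1, M2}" "g N = max (g M1) (g M2)"
    using assms(3) unfolding initial_two_matching_def by blast
  have M1: "two_matching V M1"
    using greedy_two_matching_approximation(1)[OF assms(1,4,5,6) M(1) two_matching_empty] .
  have M2: "two_matching V M2" "\<And>S. two_matching V S \<Longrightarrow> M2 \<subseteq> S \<Longrightarrow> S = M2"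
    using M(2) unfolding max_weight_two_matching_def by blast+
  show N: "two_matching V N" using M(3) M1 M2(1) by blast
  have "S = N" if "two_matching V S" "N \<subseteq> S" for S
    using that M(3) M2(2) greedy_two_matching_is_maximal[OF assms(1) M(1)] by blast
  then show "cycles_of N \<noteq> {}"
    using maximal_two_matching_has_cycle[OF assms(1,2) N] by blast
  show "g Opt \<le> 3 * g N" if "two_matching V Opt"
    using greedy_two_matching_approximation(2)[OF assms(1,4,5,6) M(1) that] M(4) by linarith
qed

lemma tour_alg_choices_exist:
  assumes "finite V" "3 \<le> card V"
    and "submodular_on (complete_edges V) g" "mono_on (Pow (complete_edges V)) g"
    and "\<And>S. S \<subseteq> complete_edges V \<Longrightarrow> 0 \<le> g S"
  shows "\<exists>N a. tour_alg_choices V g N a"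
proof -
  obtain M1 where "greedy_two_matching V g M1"
    using greedy_two_matching_exists[OF assms(1)] by blast
  moreover obtain M2 where "max_weight_two_matching V (\<lambda>e. g {e}) M2"
    using max_weight_two_matching_exists[OF assms(1)] assms(5)
    by (metis empty_subsetI insert_subset)
  ultimately have "initial_two_matching V g (if g M2 \<le> g M1 then M1 else M2)"
    unfolding initial_two_matching_def by (intro exI[of _ M1] exI[of _ M2]) auto
  then obtain N where N: "initial_two_matching V g N" by blast
  then have "two_matching V N"
    using initial_two_matching_properties(1)[OF assms(1,2) N assms(3,4) assms(5)] by blast
  then obtain a where "cycle_enumeration N a"
    using cycle_enumeration_exists two_matching_finite[OF assms(1)] by blast
  then show ?thesis using N unfolding tour_alg_choices_def by blast
qed

lemma tour_alg_output_exists: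
  assumes "finite V" "3 \<le> card V" "tour_alg_choices V g N a"
    and "submodular_on (complete_edges V) g" "mono_on (Pow (complete_edges V)) g"
    and "\<And>S. S \<subseteq> complete_edges V \<Longrightarrow> 0 \<le> g S"
  shows "\<exists>T. tour_alg_output V g N a T"
proof -
  have N: "initial_two_matching V g N" and a: "cycle_enumeration N a"
    using assms(3) unfolding tour_alg_choices_def by auto
  note props = initial_two_matching_properties[OF assms(1,2) N assms(4,5) assms(6)[OF empty_subsetI]]
  obtain i where i: "stopping_index g N a i"
    using stopping_index_exists[OF assms(1) props(1,2) a assms(4,6)] by blast
  then have "i \<in> {1..min_cycle_length N}" unfolding stopping_index_def by blast
  moreover have "two_matching V (N - removed_edges N a i)"
    using two_matching_subset[OF assms(1) props(1)] by blast
  ultimately obtain T where "T \<in> tours V" "N - removed_edges N a i \<subseteq> T"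
    using acyclic_two_matching_extends_to_tour[OF assms(1,2)]
      removal_breaks_cycles[OF assms(1) props(1) a] by metis
  then have "connects_to_tour V (N - removed_edges N a i) T"
    using connects_to_tourI[OF assms(1)] by blast
  then show ?thesis using i unfolding tour_alg_output_def by blast
qed

text \<open>The factor is \<open>2 / 3\<close> from breaking cycles of length at least 3, times \<open>1 / 3\<close> from the
  greedy 2-matching, compared with a 2-matching \<open>Opt\<close>; the connecting edges cannot lower a
  monotone value.\<close>

lemma tour_alg_output_approximation:
  assumes "finite V" "3 \<le> card V" "tour_alg_choices V g N a" "tour_alg_output V g N a T"
    and "submodular_on (complete_edges V) g" "mono_on (Pow (complete_edges V)) g"
    and "\<And>S. S \<subseteq> complete_edges V \<Longrightarrow> 0 \<le> g S" "two_matching V Opt"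
  shows "2 / 9 * g Opt \<le> g T"
proof -
  have N: "initial_two_matching V g N"
    using assms(3) unfolding tour_alg_choices_def by auto
  note props = initial_two_matching_properties[OF assms(1,2) N assms(5,6) assms(7)[OF empty_subsetI]]
  let ?k = "real (min_cycle_length N)"
  obtain i where i: "stopping_index g N a i" "connects_to_tour V (N - removed_edges N a i) T"
    using assms(4) unfolding tour_alg_output_def by blast
  have k: "3 \<le> ?k" using min_cycle_length_bounds(1)[OF assms(1) props(1,2)] by simp
  have T: "T \<subseteq> complete_edges V" "N - removed_edges N a i \<subseteq> T"
    using i(2) tours_two_matching(1) unfolding connects_to_tour_def two_matching_def by blast+
  have "0 \<le> g N" using assms(7) props(1) unfolding two_matching_def by blast
  then have "2 / 3 * g N \<le> (?k - 1) / ?k * g N"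
    using k by (intro mult_right_mono) (auto simp: field_simps)
  also have "\<dots> \<le> g (N - removed_edges N a i)"
    using i(1) unfolding stopping_index_def good_index_def by blast
  also have "\<dots> \<le> g T" using assms(6) T by (auto intro: mono_onD)
  finally show ?thesis using props(3)[OF assms(8)] by linarith
qed

theorem mainTheorem7:
  fixes V :: "'v set"
    and E :: "'v set set"
    and w :: "'v set set \<Rightarrow> real"
    and c :: "'v set \<Rightarrow> real"
    and M \<beta> OPT :: real
    and f f' :: "'v set set \<Rightarrow> real"
  assumes "finite V"
    and "card V \<ge> 3"
    and "E = complete_edges V"
    and "\<And>S. S \<subseteq> E \<Longrightarrow> 0 \<le> w S"
    and "mono_on (Pow E) w"
    and "submodular_on E w"
    and "\<And>e. e \<in> E \<Longrightarrow> 0 \<le> c e"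
    and "M = Max (c ` E)"
    and "0 \<le> \<beta>"
    and "\<beta> \<le> 1"
    and "f = objective \<beta> w c"
    and "f' = modified_objective \<beta> w c M"
    and "OPT = Max (f ` tours V)"
  shows "(\<exists>N a. tour_alg_choices V f' N a) \<and>
    (\<forall>N a. tour_alg_choices V f' N a \<longrightarrow>
       (\<exists>T. tour_alg_output V f' N a T) \<and>
       (\<forall>T. tour_alg_output V f' N a T \<longrightarrow>
          T \<in> tours V \<and> f T \<ge> 2 / 9 * OPT - 7 / 9 * \<beta> * M * real (card V)))"
proof -
  have E: "finite E" "\<And>e. e \<in> E \<Longrightarrow> c e \<le> M"
    using assms(1,3,8) by (auto simp: finite_complete_edges)
  have g: "submodular_on (complete_edges V) f'" "mono_on (Pow (complete_edges V)) f'"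
      "\<And>S. S \<subseteq> complete_edges V \<Longrightarrow> 0 \<le> f' S"
    unfolding assms(3)[symmetric] assms(12)
    using E assms(4-6,9,10) modified_objective_properties[of E w c M \<beta>] by blast+
  \<comment> \<open>All tours have the same number of edges, so on tours the two objectives differ by a constant.\<close>
  have shift: "f' T = f T + \<beta> * M * real (card V)" if "T \<in> tours V" for T
    using tours_two_matching(3)[OF that] assms(11,12) by (simp add: modified_objective_def)
  have "\<not> is_cycle A" if "A \<subseteq> {}" for A :: "'v set set"
    using that is_cycle_degree(2)[of A] by auto
  then have "tours V \<noteq> {}"
    using acyclic_two_matching_extends_to_tour[OF assms(1,2) two_matching_empty] by blast
  then have "OPT \<in> f ` tours V"
    using assms(13) finite_tours[OF assms(1)] by (auto intro: Max_in)
  then obtain Opt where Opt: "Opt \<in> tours V" "OPT = f Opt" by blast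
  show ?thesis
  proof (intro conjI allI impI)
    show "\<exists>N a. tour_alg_choices V f' N a"
      using tour_alg_choices_exist[OF assms(1,2) g] .
    fix N a assume choices: "tour_alg_choices V f' N a"
    show "\<exists>T. tour_alg_output V f' N a T"
      using tour_alg_output_exists[OF assms(1,2) choices g] .
    fix T assume out: "tour_alg_output V f' N a T"
    show T: "T \<in> tours V"
      using out unfolding tour_alg_output_def connects_to_tour_def by blast
    have "2 / 9 * f' Opt \<le> f' T"
      using tour_alg_output_approximation[OF assms(1,2) choices out g
          tours_two_matching(1)[OF Opt(1)]] .
    then show "f T \<ge> 2 / 9 * OPT - 7 / 9 * \<beta> * M * real (card V)"
      using shift[OF T] shift[OF Opt(1)] Opt(2) by (simp add: algebra_simps)
  qed
qed

end
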